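(* Let $n\geq 3$ be a natural number, $R$ a commutative ring and $\sigma\in GL_n(R)$. Let $i,j,k,l\in\{1,\dots,n\}$ with $i\neq j$ and $k\neq l$. Then (i) $t_{kl}(\sigma_{ij})$ is a product of $8$ elementary $\sigma$-conjugates, and (ii) $t_{kl}(\sigma_{ii}-\sigma_{jj})$ is a product of $24$ elementary $\sigma$-conjugates.
   Context: Rings are associative with $1\neq 0$. $GL_n(R)$ is the group of invertible $n\times n$ matrices over $R$, and $\sigma_{ij}$ is the entry of $\sigma$ at position $(i,j)$. Let $e$ be the identity matrix and $e^{ij}$ the matrix with $1$ at position $(i,j)$ and zeros elsewhere. For $i\neq j$ and $x\in R$, the elementary transvection is $t_{ij}(x):=e+xe^{ij}$. The elementary subgroup $E_n(R)$ is the subgroup of $GL_n(R)$ generated by all elementary transvections. For group elements $g,h$ put ${}^hg:=hgh^{-1}$. An elementary $\sigma$-conjugate is a matrix of the form ${}^{\epsilon}\sigma$ or ${}^{\epsilon}(\sigma^{-1})$ with $\epsilon\in E_n(R)$ (different factors of a product may use different $\epsilon$ and different signs). *)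

theory Defs
  imports "HOL-Analysis.Cartesian_Space" "HOL-Algebra.Generated_Groups"
begin

definition GL :: "('a::comm_ring_1 ^ 'n ^ 'n) monoid" where
  "GL = \<lparr>carrier = {A. invertible A}, monoid.mult = (**), one = mat 1\<rparr>"

lemma group_GL: "group (GL :: ('a::comm_ring_1 ^ 'n ^ 'n) monoid)"
proof (rule groupI)
  fix A :: "'a ^ 'n ^ 'n"
  assume "A \<in> carrier GL"
  then obtain B where "A ** B = mat 1" "B ** A = mat 1"
    by (auto simp: GL_def invertible_def)
  then show "\<exists>B\<in>carrier GL. B \<otimes>\<^bsub>GL\<^esub> A = \<one>\<^bsub>GL\<^esub>"
    by (auto simp: GL_def invertible_def)
next
  fix A B :: "'a ^ 'n ^ 'n"
  assume "A \<in> carrier GL" "B \<in> carrier GL"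
  then show "A \<otimes>\<^bsub>GL\<^esub> B \<in> carrier GL"
    by (simp add: GL_def invertible_mult)
next
  show "\<one>\<^bsub>GL\<^esub> \<in> carrier (GL :: ('a ^ 'n ^ 'n) monoid)"
    unfolding GL_def invertible_def
    by (auto intro!: exI [of _ "mat 1 :: 'a ^ 'n ^ 'n"])
qed (auto simp: GL_def matrix_mul_assoc)

definition transvection :: "'n::finite \<Rightarrow> 'n \<Rightarrow> 'a::comm_ring_1 \<Rightarrow> 'a ^ 'n ^ 'n" where
  "transvection i j x = mat 1 + (\<chi> a b. if a = i \<and> b = j then x else 0)"

lemma transvection_mult:
  fixes i j :: "'n::finite" and x y :: "'a::comm_ring_1"
  assumes "i \<noteq> j"
  shows "transvection i j x ** transvection i j y = transvection i j (x + y)"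
proof -
  let ?E = "\<lambda>z::'a. (\<chi> a b. if a = i \<and> b = j then z else 0) :: 'a ^ 'n ^ 'n"
  have "?E x ** ?E y = 0"
    using assms by (auto simp: vec_eq_iff matrix_matrix_mult_def intro!: sum.neutral)
  moreover have "?E x + ?E y = ?E (x + y)"
    by (simp add: vec_eq_iff)
  moreover have "(A + B) ** C = A ** C + B ** C" for A B C :: "'a ^ 'n ^ 'n"
    by (simp add: matrix_matrix_mult_def vec_eq_iff distrib_right sum.distrib)
  ultimately show ?thesis
    by (simp add: transvection_def matrix_add_ldistrib add.assoc add.commute add.left_commute)
qed

lemma transvection_in_GL:
  fixes i j :: "'n::finite" and x :: "'a::comm_ring_1"
  assumes "i \<noteq> j"
  shows "transvection i j x \<in> carrier GL"
proof -
  have "transvection i j 0 = (mat 1 :: 'a ^ 'n ^ 'n)"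
    by (simp add: transvection_def vec_eq_iff)
  then show ?thesis
    using transvection_mult [OF assms, of x "- x"] transvection_mult [OF assms, of "- x" x]
    by (auto simp: GL_def invertible_def)
qed

definition elementary_group :: "('a::comm_ring_1 ^ 'n ^ 'n) set" where
  "elementary_group = generate GL {transvection i j x | i j x. i \<noteq> j}"

definition elementary_conjugates :: "'a::comm_ring_1 ^ 'n ^ 'n \<Rightarrow> ('a ^ 'n ^ 'n) set" where
  "elementary_conjugates \<sigma> =
     {\<epsilon> \<otimes>\<^bsub>GL\<^esub> \<tau> \<otimes>\<^bsub>GL\<^esub> inv\<^bsub>GL\<^esub> \<epsilon> | \<epsilon> \<tau>.
        \<epsilon> \<in> elementary_group \<and> \<tau> \<in> {\<sigma>, inv\<^bsub>GL\<^esub> \<sigma>}}"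

text \<open>The number of factors is exact; factors may be repeated.\<close>

definition product_of_conjugates :: "nat \<Rightarrow> 'a::comm_ring_1 ^ 'n ^ 'n \<Rightarrow> 'a ^ 'n ^ 'n \<Rightarrow> bool" where
  "product_of_conjugates m \<sigma> A \<longleftrightarrow>
     (\<exists>cs. length cs = m \<and> set cs \<subseteq> elementary_conjugates \<sigma> \<and>
           A = foldr (\<lambda>B C. B \<otimes>\<^bsub>GL\<^esub> C) cs \<one>\<^bsub>GL\<^esub>)"

end

theory Submission imports Defs begin

text \<open>
  Fix a third index \<open>p\<close> and put \<open>\<tau> = t\<^sub>i\<^sub>p(-\<sigma>\<^sub>i\<^sub>j) t\<^sub>j\<^sub>p(\<sigma>\<^sub>i\<^sub>i)\<close>. Row \<open>i\<close> of \<open>\<sigma>\<tau>\<close> equals row \<open>i\<close> of \<open>\<sigma>\<close>,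
  so row \<open>i\<close> of \<open>\<rho> = \<sigma>\<tau>\<sigma>\<^sup>-\<^sup>1\<close> is trivial and \<open>\<rho> t\<^sub>j\<^sub>i(1) \<rho>\<^sup>-\<^sup>1\<close> differs from the identity only in
  column \<open>i\<close>; hence it commutes with \<open>t\<^sub>p\<^sub>i(1)\<close>. The matrix \<open>\<theta> = \<tau> t\<^sub>j\<^sub>i(-1) \<tau>\<^sup>-\<^sup>1 \<cdot> \<rho> t\<^sub>j\<^sub>i(1) \<rho>\<^sup>-\<^sup>1\<close> is
  conjugate to the commutator of \<open>t\<^sub>j\<^sub>i(1)\<close> and \<open>[\<tau>\<^sup>-\<^sup>1, \<sigma>]\<close>, so it is a product of four conjugates,
  and \<open>\<tau> t\<^sub>j\<^sub>i(-1) \<tau>\<^sup>-\<^sup>1 = t\<^sub>j\<^sub>p(-\<sigma>\<^sub>i\<^sub>j) t\<^sub>j\<^sub>i(-1)\<close>. Therefore \<open>[\<theta>, t\<^sub>p\<^sub>i(1)] = t\<^sub>j\<^sub>i(-\<sigma>\<^sub>i\<^sub>j)\<close> is a product of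
  eight. For the second part, apply the first one to \<open>t\<^sub>i\<^sub>j(1) \<sigma> t\<^sub>i\<^sub>j(-1)\<close>, whose entry at \<open>(i, j)\<close> is
  \<open>\<sigma>\<^sub>i\<^sub>j + \<sigma>\<^sub>j\<^sub>j - \<sigma>\<^sub>i\<^sub>i - \<sigma>\<^sub>j\<^sub>i\<close>.
\<close>

section \<open>Matrix arithmetic in the general linear group\<close>

interpretation GL: group "GL :: ('a::comm_ring_1 ^ 'n ^ 'n) monoid"
  rewrites "monoid.mult (GL :: ('a ^ 'n ^ 'n) monoid) = (**)"
    and "one (GL :: ('a ^ 'n ^ 'n) monoid) = mat 1"
  by (simp_all add: group_GL, simp_all add: GL_def)

lemma GL_simps: "monoid.mult GL = (**)" "one GL = mat 1"
  by (simp_all add: GL_def)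

lemma matrix_add_rdistrib':
  fixes A B C :: "'a::comm_ring_1 ^ 'n ^ 'n"
  shows "(A + B) ** C = A ** C + B ** C"
  by (simp add: matrix_matrix_mult_def vec_eq_iff distrib_right sum.distrib)

lemma matrix_diff_distrib:
  fixes A B C :: "'a::comm_ring_1 ^ 'n ^ 'n"
  shows "(A - B) ** C = A ** C - B ** C" "C ** (A - B) = C ** A - C ** B"
  by (simp_all add: matrix_matrix_mult_def vec_eq_iff left_diff_distrib right_diff_distrib
      sum_subtractf)

definition matrix_unit :: "'n::finite \<Rightarrow> 'n \<Rightarrow> 'a::comm_ring_1 \<Rightarrow> 'a ^ 'n ^ 'n" where
  "matrix_unit i j x = (\<chi> a b. if a = i \<and> b = j then x else 0)"

lemma transvection_eq: "transvection i j x = mat 1 + matrix_unit i j x"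
  by (simp add: transvection_def matrix_unit_def)

lemma matrix_unit_add: "matrix_unit i j (x + y) = matrix_unit i j x + matrix_unit i j y"
  and matrix_unit_minus: "matrix_unit i j (- x) = - matrix_unit i j x"
  and matrix_unit_0: "matrix_unit i j 0 = 0"
  by (auto simp: matrix_unit_def vec_eq_iff)

text \<open>Sandwiching \<open>M\<close> between two matrix units isolates one entry of
  \<open>M\<close> and places it at a chosen position. Entries of \<sigma> enter the later
  computations through this identity.\<close>

lemma matrix_unit_mult_mult:
  "matrix_unit k i x ** M ** matrix_unit j l y = matrix_unit k l (x * M $ i $ j * y)"
proof -
  have "(matrix_unit k i x ** M) $ a $ c = (if a = k then x * M $ i $ c else 0)" for a c
    by (simp add: matrix_unit_def matrix_matrix_mult_def if_distrib[of "\<lambda>z. z * _"]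
        sum.delta cong: if_cong)
  then show ?thesis
    by (auto simp: matrix_matrix_mult_def[of _ "matrix_unit j l y"] vec_eq_iff)
       (auto simp: matrix_unit_def if_distrib[of "\<lambda>z. _ * z"] sum.delta cong: if_cong)
qed

lemma matrix_unit_mult:
  "matrix_unit k i x ** matrix_unit j l y = (if i = j then matrix_unit k l (x * y) else 0)"
  using matrix_unit_mult_mult[of k i x "mat 1" j l y, unfolded matrix_mul_rid]
  by (simp add: mat_def matrix_unit_0)

lemma matrix_mult_0: "0 ** A = (0 :: 'a::comm_ring_1 ^ 'n ^ 'n)" "A ** 0 = (0 :: 'a ^ 'n ^ 'n)"
  by (simp_all add: matrix_matrix_mult_def vec_eq_iff)

text \<open>Expands both sides of an identity between words in transvections into sums of matrix
  units, which can then be compared.\<close>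

lemmas transvection_algebra =
  transvection_eq matrix_add_ldistrib matrix_add_rdistrib' matrix_diff_distrib matrix_unit_mult
  matrix_mul_assoc[symmetric] matrix_mult_0

lemma transvection_0: "transvection i j 0 = mat 1"
  by (simp add: transvection_eq matrix_unit_0)

lemma inv_transvection:
  assumes "i \<noteq> j"
  shows "inv\<^bsub>GL\<^esub> (transvection i j x) = transvection i j (- x)"
  using assms
  by (intro GL.inv_equality) (simp_all add: transvection_in_GL transvection_mult transvection_0)

section \<open>The elementary subgroup and elementary conjugates\<close>

lemma transvection_in_elementary_group:
  "i \<noteq> j \<Longrightarrow> transvection i j x \<in> elementary_group"
  unfolding elementary_group_def by (intro generate.incl) auto

lemma elementary_group_subgroup: "subgroup elementary_group GL"
  unfolding elementary_group_def
  by (rule GL.generate_is_subgroup) (auto simp: transvection_in_GL)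

lemmas elementary_group_mult = subgroup.m_closed[OF elementary_group_subgroup, unfolded GL_simps]
lemmas elementary_group_inv = subgroup.m_inv_closed[OF elementary_group_subgroup]
lemmas elementary_group_one = subgroup.one_closed[OF elementary_group_subgroup, unfolded GL_simps]
lemmas elementary_group_GL = subgroup.mem_carrier[OF elementary_group_subgroup]

lemma GL_cancel:
  assumes "A \<in> carrier GL"
  shows "A ** (inv\<^bsub>GL\<^esub> A ** B) = B" "inv\<^bsub>GL\<^esub> A ** (A ** B) = B"
  using assms by (simp_all add: matrix_mul_assoc)

lemma elementary_conjugates_iff:
  "c \<in> elementary_conjugates \<sigma> \<longleftrightarrow>
     (\<exists>\<epsilon>\<in>elementary_group. c = \<epsilon> ** \<sigma> ** inv\<^bsub>GL\<^esub> \<epsilon> \<or> c = \<epsilon> ** inv\<^bsub>GL\<^esub> \<sigma> ** inv\<^bsub>GL\<^esub> \<epsilon>)"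
  unfolding elementary_conjugates_def GL_simps by blast

context
  fixes \<sigma> :: "'a::comm_ring_1 ^ 'n::finite ^ 'n"
  assumes \<sigma>: "\<sigma> \<in> carrier GL"
begin

lemma elementary_conjugates_GL: "c \<in> elementary_conjugates \<sigma> \<Longrightarrow> c \<in> carrier GL"
  using \<sigma> by (auto simp: elementary_conjugates_iff elementary_group_GL)

lemma elementary_conjugates_inv:
  assumes "c \<in> elementary_conjugates \<sigma>"
  shows "inv\<^bsub>GL\<^esub> c \<in> elementary_conjugates \<sigma>"
  using assms \<sigma>
  by (auto simp: elementary_conjugates_iff elementary_group_GL GL.inv_mult_group matrix_mul_assoc)

lemma elementary_conjugates_conj:
  assumes "c \<in> elementary_conjugates \<sigma>" "\<epsilon> \<in> elementary_group"
  shows "\<epsilon> ** c ** inv\<^bsub>GL\<^esub> \<epsilon> \<in> elementary_conjugates \<sigma>"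
proof -
  from assms(1) obtain \<delta> where \<delta>: "\<delta> \<in> elementary_group"
    "c = \<delta> ** \<sigma> ** inv\<^bsub>GL\<^esub> \<delta> \<or> c = \<delta> ** inv\<^bsub>GL\<^esub> \<sigma> ** inv\<^bsub>GL\<^esub> \<delta>"
    by (auto simp: elementary_conjugates_iff)
  with assms(2) show ?thesis
    unfolding elementary_conjugates_iff
    by (intro bexI[of _ "\<epsilon> ** \<delta>"])
       (auto simp: elementary_group_mult elementary_group_GL GL.inv_mult_group matrix_mul_assoc)
qed

section \<open>Counting factors in products of conjugates\<close>

lemma product_of_conjugates_0: "product_of_conjugates 0 \<sigma> A \<longleftrightarrow> A = mat 1"
  by (simp add: product_of_conjugates_def GL_simps)

lemma product_of_conjugates_Suc:
  "product_of_conjugates (Suc m) \<sigma> A \<longleftrightarrow>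
     (\<exists>c B. c \<in> elementary_conjugates \<sigma> \<and> product_of_conjugates m \<sigma> B \<and> A = c ** B)"
proof
  assume "product_of_conjugates (Suc m) \<sigma> A"
  then obtain cs where cs: "length cs = Suc m" "set cs \<subseteq> elementary_conjugates \<sigma>"
    "A = foldr (**) cs (mat 1)"
    by (auto simp: product_of_conjugates_def GL_simps)
  then obtain c cs' where "cs = c # cs'"
    by (cases cs) auto
  with cs show "\<exists>c B. c \<in> elementary_conjugates \<sigma> \<and> product_of_conjugates m \<sigma> B \<and> A = c ** B"
    by (auto simp: product_of_conjugates_def GL_simps)
next
  assume "\<exists>c B. c \<in> elementary_conjugates \<sigma> \<and> product_of_conjugates m \<sigma> B \<and> A = c ** B"
  then obtain c cs where "c \<in> elementary_conjugates \<sigma>" "length cs = m"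
    "set cs \<subseteq> elementary_conjugates \<sigma>" "A = c ** foldr (**) cs (mat 1)"
    by (auto simp: product_of_conjugates_def GL_simps)
  then show "product_of_conjugates (Suc m) \<sigma> A"
    unfolding product_of_conjugates_def GL_simps by (intro exI[of _ "c # cs"]) auto
qed

lemma product_of_conjugates_1: "product_of_conjugates 1 \<sigma> A \<longleftrightarrow> A \<in> elementary_conjugates \<sigma>"
  by (simp add: product_of_conjugates_Suc product_of_conjugates_0)

lemma product_of_conjugates_GL: "product_of_conjugates m \<sigma> A \<Longrightarrow> A \<in> carrier GL"
  by (induction m arbitrary: A)
     (auto simp: product_of_conjugates_0 product_of_conjugates_Suc elementary_conjugates_GL)

lemma product_of_conjugates_mult:
  assumes "product_of_conjugates m \<sigma> A" "product_of_conjugates n \<sigma> B"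
  shows "product_of_conjugates (m + n) \<sigma> (A ** B)"
  using assms(1)
proof (induction m arbitrary: A)
  case 0
  with assms(2) show ?case
    by (simp add: product_of_conjugates_0)
next
  case (Suc m)
  then show ?case
    by (simp add: product_of_conjugates_Suc) (metis matrix_mul_assoc)
qed

lemma product_of_conjugates_inv:
  assumes "product_of_conjugates m \<sigma> A"
  shows "product_of_conjugates m \<sigma> (inv\<^bsub>GL\<^esub> A)"
  using assms
proof (induction m arbitrary: A)
  case 0
  then show ?case
    by (simp add: product_of_conjugates_0)
next
  case (Suc m)
  then obtain c B where c: "c \<in> elementary_conjugates \<sigma>" "product_of_conjugates m \<sigma> B" "A = c ** B"
    by (auto simp: product_of_conjugates_Suc)
  then have "product_of_conjugates (m + 1) \<sigma> (inv\<^bsub>GL\<^esub> B ** inv\<^bsub>GL\<^esub> c)"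
    by (intro product_of_conjugates_mult Suc.IH)
       (simp_all only: product_of_conjugates_1 elementary_conjugates_inv)
  with c show ?case
    by (simp add: GL.inv_mult_group elementary_conjugates_GL product_of_conjugates_GL)
qed

lemma product_of_conjugates_conj:
  assumes "product_of_conjugates m \<sigma> A" and \<epsilon>: "\<epsilon> \<in> elementary_group"
  shows "product_of_conjugates m \<sigma> (\<epsilon> ** A ** inv\<^bsub>GL\<^esub> \<epsilon>)"
  using assms(1)
proof (induction m arbitrary: A)
  case 0
  then show ?case
    using \<epsilon> by (simp add: product_of_conjugates_0 elementary_group_GL)
next
  case (Suc m)
  then obtain c B where c: "c \<in> elementary_conjugates \<sigma>" "product_of_conjugates m \<sigma> B" "A = c ** B"
    by (auto simp: product_of_conjugates_Suc)
  have "\<epsilon> ** A ** inv\<^bsub>GL\<^esub> \<epsilon> = (\<epsilon> ** c ** inv\<^bsub>GL\<^esub> \<epsilon>) ** (\<epsilon> ** B ** inv\<^bsub>GL\<^esub> \<epsilon>)"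
    using \<epsilon> by (simp add: c(3) matrix_mul_assoc[symmetric] GL_cancel elementary_group_GL)
  with c \<epsilon> Suc.IH show ?case
    unfolding product_of_conjugates_Suc using elementary_conjugates_conj by blast
qed

text \<open>Writing the conjugation as \<open>\<epsilon> ** A = B ** \<epsilon>\<close> avoids the
  inverse of \<epsilon>, so for words in transvections it can be checked by expansion.\<close>

lemma product_of_conjugates_conj_eq:
  assumes "product_of_conjugates m \<sigma> A" "\<epsilon> \<in> elementary_group" "\<epsilon> ** A = B ** \<epsilon>"
    and "B \<in> carrier GL"
  shows "product_of_conjugates m \<sigma> B"
proof -
  have "\<epsilon> ** A ** inv\<^bsub>GL\<^esub> \<epsilon> = B"
    using assms by (simp add: elementary_group_GL flip: matrix_mul_assoc)
  with product_of_conjugates_conj[OF assms(1,2)] show ?thesis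
    by simp
qed

text \<open>The commutator is \<open>A\<close> times the \<epsilon>-conjugate of the inverse of
  \<open>A\<close>, and inversion and conjugation both preserve the count. Each commutator thus
  doubles it: 1, 2, 4, 8.\<close>

lemma product_of_conjugates_commutator:
  assumes "product_of_conjugates m \<sigma> A" "\<epsilon> \<in> elementary_group"
  shows "product_of_conjugates (m + m) \<sigma> (A ** \<epsilon> ** inv\<^bsub>GL\<^esub> A ** inv\<^bsub>GL\<^esub> \<epsilon>)"
  using product_of_conjugates_mult[OF assms(1)
      product_of_conjugates_conj[OF product_of_conjugates_inv[OF assms(1)] assms(2)]]
  by (simp add: matrix_mul_assoc)

lemma product_of_conjugates_self: "product_of_conjugates 1 \<sigma> \<sigma>"
  unfolding product_of_conjugates_1 elementary_conjugates_iff
  by (intro bexI[of _ "mat 1"]) (simp_all add: elementary_group_one)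

section \<open>Moving a transvection to another position\<close>

lemma product_of_conjugates_transvection_column:
  assumes "product_of_conjugates m \<sigma> (transvection i j x)" "i \<noteq> j" "i \<noteq> l"
  shows "product_of_conjugates m \<sigma> (transvection i l x)"
proof (cases "j = l")
  case False
  show ?thesis
  proof (rule product_of_conjugates_conj_eq[OF assms(1)])
    \<comment> \<open>Conjugation by t_jl(-1) copies the entry \<open>x\<close> from column
      \<open>j\<close> into column \<open>l\<close>; conjugation by t_lj(1) then clears column
      \<open>j\<close>. The sign of \<open>x\<close> is unchanged.\<close>
    show "transvection l j 1 ** transvection j l (- 1) \<in> elementary_group"
      using False by (intro elementary_group_mult transvection_in_elementary_group) auto
    show "transvection l j 1 ** transvection j l (- 1) ** transvection i j x =
        transvection i l x ** (transvection l j 1 ** transvection j l (- 1))"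
      using assms False by (auto simp: transvection_algebra matrix_unit_minus)
  qed (use assms in \<open>simp add: transvection_in_GL\<close>)
qed (use assms in simp)

lemma product_of_conjugates_transvection_row:
  assumes "product_of_conjugates m \<sigma> (transvection i j x)" "i \<noteq> j" "k \<noteq> j"
  shows "product_of_conjugates m \<sigma> (transvection k j x)"
proof (cases "i = k")
  case False
  show ?thesis
  proof (rule product_of_conjugates_conj_eq[OF assms(1)])
    \<comment> \<open>The same with rows: t_ki(1) copies \<open>x\<close> into row \<open>k\<close>,
      and t_ik(-1) clears row \<open>i\<close>.\<close>
    show "transvection i k (- 1) ** transvection k i 1 \<in> elementary_group"
      using False by (intro elementary_group_mult transvection_in_elementary_group) auto
    show "transvection i k (- 1) ** transvection k i 1 ** transvection i j x =
        transvection k j x ** (transvection i k (- 1) ** transvection k i 1)"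
      using assms False by (auto simp: transvection_algebra matrix_unit_minus)
  qed (use assms in \<open>simp add: transvection_in_GL\<close>)
qed (use assms in simp)

lemma product_of_conjugates_transvection_move:
  assumes "product_of_conjugates m \<sigma> (transvection i j x)" "i \<noteq> j" "k \<noteq> l"
    and "p \<noteq> i" "p \<noteq> j"
  shows "product_of_conjugates m \<sigma> (transvection k l x)"
proof (cases "k = j")
  case True
  \<comment> \<open>Changing the row first would land on the diagonal position (j, j), so the route
    passes through column \<open>p\<close>.\<close>
  have "product_of_conjugates m \<sigma> (transvection i p x)"
    using product_of_conjugates_transvection_column[OF assms(1)] assms by auto
  then have "product_of_conjugates m \<sigma> (transvection k p x)"
    using product_of_conjugates_transvection_row True assms by metis
  then show ?thesis
    using product_of_conjugates_transvection_column True assms by metis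
next
  case False
  then have "product_of_conjugates m \<sigma> (transvection k j x)"
    using product_of_conjugates_transvection_row assms by metis
  then show ?thesis
    using product_of_conjugates_transvection_column False assms by metis
qed

lemma product_of_conjugates_transvection_minus:
  assumes "product_of_conjugates m \<sigma> (transvection i j x)" "i \<noteq> j"
  shows "product_of_conjugates m \<sigma> (transvection i j (- x))"
  using product_of_conjugates_inv[OF assms(1)] assms(2) by (simp add: inv_transvection)

section \<open>Off-diagonal entries\<close>

lemma product_of_8_conjugates_aux:
  assumes distinct: "i \<noteq> j" "p \<noteq> i" "p \<noteq> j"
  shows "product_of_conjugates 8 \<sigma> (transvection j i (- (\<sigma> $ i $ j)))"
proof -
  define a where "a = \<sigma> $ i $ j"
  define \<tau> where "\<tau> = transvection i p (- a) ** transvection j p (\<sigma> $ i $ i)"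
  define \<rho> where "\<rho> = \<sigma> ** \<tau> ** inv\<^bsub>GL\<^esub> \<sigma>"
  define t where "t = (transvection j i 1 :: 'a ^ 'n ^ 'n)"
  define s where "s = (transvection p i 1 :: 'a ^ 'n ^ 'n)"
  have \<tau>E: "\<tau> \<in> elementary_group"
    unfolding \<tau>_def using distinct
    by (intro elementary_group_mult transvection_in_elementary_group) auto
  have tE: "t \<in> elementary_group" and sE: "s \<in> elementary_group"
    using distinct by (auto simp: t_def s_def transvection_in_elementary_group)
  note GL = \<sigma> \<tau>E[THEN elementary_group_GL] tE[THEN elementary_group_GL] sE[THEN elementary_group_GL]
  have \<rho>GL: "\<rho> \<in> carrier GL"
    using GL by (simp add: \<rho>_def)
  have tinv: "inv\<^bsub>GL\<^esub> t = transvection j i (- 1)"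
    using distinct by (simp add: t_def inv_transvection)

  \<comment> \<open>This says that row \<open>i\<close> of \<rho> is that of the identity.
    Multiplying \<sigma> by \<tau> changes row \<open>i\<close> only in column \<open>p\<close>, by
    \<open>\<sigma> $ i $ i * (- a) + a * \<sigma> $ i $ i\<close>, which is zero by
    commutativity.\<close>
  have row: "matrix_unit k i 1 ** \<rho> = matrix_unit k i 1" for k
  proof -
    have \<tau>_eq: "\<tau> = mat 1 + (matrix_unit i p (- a) + matrix_unit j p (\<sigma> $ i $ i))"
      using distinct by (simp add: \<tau>_def transvection_algebra add_ac)
    have "matrix_unit k i 1 ** \<sigma> ** \<tau> = matrix_unit k i 1 ** \<sigma>"
      unfolding \<tau>_eq matrix_add_ldistrib matrix_unit_mult_mult
      by (simp add: a_def matrix_unit_minus mult.commute)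
    then have "matrix_unit k i 1 ** \<rho> = matrix_unit k i 1 ** \<sigma> ** inv\<^bsub>GL\<^esub> \<sigma>"
      by (simp add: \<rho>_def matrix_mul_assoc)
    then show ?thesis
      using \<sigma> by (simp add: matrix_mul_assoc[symmetric])
  qed
  have row_inv: "matrix_unit k i 1 ** inv\<^bsub>GL\<^esub> \<rho> = matrix_unit k i 1" for k
    using arg_cong[OF row[of k], of "\<lambda>X. X ** inv\<^bsub>GL\<^esub> \<rho>"] \<rho>GL
    by (simp flip: matrix_mul_assoc)

  define B where "B = \<rho> ** t ** inv\<^bsub>GL\<^esub> \<rho>"
  have B_eq: "B = mat 1 + \<rho> ** matrix_unit j i 1"
    using \<rho>GL
    by (simp add: B_def t_def transvection_eq matrix_add_ldistrib matrix_add_rdistrib' row_inv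
        flip: matrix_mul_assoc)
  \<comment> \<open>With \<open>B\<close> = 1 + \<open>\<rho> ** matrix_unit j i 1\<close> and
    \<open>s\<close> = 1 + \<open>matrix_unit p i 1\<close>, both mixed products vanish: this one by
    \<open>row\<close> and i \<noteq> j, the other by i \<noteq> p.\<close>
  have "matrix_unit p i 1 ** (\<rho> ** matrix_unit j i 1) = 0"
    using distinct by (simp add: matrix_mul_assoc row matrix_unit_mult)
  then have B_s: "B ** s = s ** B"
    using distinct unfolding B_eq s_def by (simp add: transvection_algebra add_ac)
  define A where "A = \<tau> ** inv\<^bsub>GL\<^esub> t ** inv\<^bsub>GL\<^esub> \<tau>"
  \<comment> \<open>The factor t_jp of \<tau> commutes with t_ji and t_jp, so
    \<open>\<sigma> $ i $ i\<close> drops out; only conjugation by t_ip(-a) has an effect.\<close>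
  have "\<tau> ** inv\<^bsub>GL\<^esub> t = transvection j p (- a) ** transvection j i (- 1) ** \<tau>"
    using distinct unfolding \<tau>_def tinv
    by (auto simp: transvection_algebra matrix_unit_minus add_ac)
  then have A_eq: "A = transvection j p (- a) ** transvection j i (- 1)"
    using GL by (simp add: A_def flip: matrix_mul_assoc)
  \<comment> \<open>Here t_ji(-1) commutes with \<open>s\<close>, while the commutator of t_jp(-a)
    and t_pi(1) is t_ji(-a).\<close>
  have A_s: "A ** s = transvection j i (- a) ** s ** A"
    using distinct unfolding A_eq s_def
    by (auto simp: transvection_algebra matrix_unit_minus add_ac)
  have AB_GL: "A \<in> carrier GL" "B \<in> carrier GL"
    using GL \<rho>GL by (simp_all add: A_def B_def)

  \<comment> \<open>First doubling: the commutator of \<sigma> with the inverse of \<tau>. Its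
    inverse is then commuted with \<open>t\<close>, giving four factors.\<close>
  have "product_of_conjugates (1 + 1) \<sigma> (\<sigma> ** inv\<^bsub>GL\<^esub> \<tau> ** inv\<^bsub>GL\<^esub> \<sigma> ** inv\<^bsub>GL\<^esub> (inv\<^bsub>GL\<^esub> \<tau>))"
    by (intro product_of_conjugates_commutator product_of_conjugates_self
        elementary_group_inv \<tau>E)
  moreover have "\<sigma> ** inv\<^bsub>GL\<^esub> \<tau> ** inv\<^bsub>GL\<^esub> \<sigma> ** inv\<^bsub>GL\<^esub> (inv\<^bsub>GL\<^esub> \<tau>) = inv\<^bsub>GL\<^esub> \<rho> ** \<tau>"
    using GL by (simp add: \<rho>_def GL.inv_mult_group matrix_mul_assoc)
  ultimately have "product_of_conjugates (1 + 1) \<sigma> (inv\<^bsub>GL\<^esub> (inv\<^bsub>GL\<^esub> \<rho> ** \<tau>))"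
    by (intro product_of_conjugates_inv) simp
  then have "product_of_conjugates ((1 + 1) + (1 + 1)) \<sigma>
      (inv\<^bsub>GL\<^esub> \<tau> ** \<rho> ** t ** (inv\<^bsub>GL\<^esub> \<rho> ** \<tau>) ** inv\<^bsub>GL\<^esub> t)"
    using product_of_conjugates_commutator[OF _ tE] GL \<rho>GL
    by (fastforce simp: GL.inv_mult_group)
  \<comment> \<open>Conjugating by this element keeps the count and cancels the outer factors,
    leaving \<open>A ** B\<close>, the \<theta> of the overview.\<close>
  from product_of_conjugates_conj[OF this, of "\<tau> ** inv\<^bsub>GL\<^esub> t"] \<tau>E tE
  have "product_of_conjugates 4 \<sigma> (\<tau> ** inv\<^bsub>GL\<^esub> t **
      (inv\<^bsub>GL\<^esub> \<tau> ** \<rho> ** t ** (inv\<^bsub>GL\<^esub> \<rho> ** \<tau>) ** inv\<^bsub>GL\<^esub> t) ** inv\<^bsub>GL\<^esub> (\<tau> ** inv\<^bsub>GL\<^esub> t))"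
    by (simp add: elementary_group_mult elementary_group_inv eval_nat_numeral)
  moreover have "\<tau> ** inv\<^bsub>GL\<^esub> t ** (inv\<^bsub>GL\<^esub> \<tau> ** \<rho> ** t ** (inv\<^bsub>GL\<^esub> \<rho> ** \<tau>) ** inv\<^bsub>GL\<^esub> t) **
      inv\<^bsub>GL\<^esub> (\<tau> ** inv\<^bsub>GL\<^esub> t) = A ** B"
    using GL \<rho>GL
    by (simp add: A_def B_def GL.inv_mult_group GL_cancel flip: matrix_mul_assoc)
  ultimately have "product_of_conjugates 4 \<sigma> (A ** B)"
    by simp
  from product_of_conjugates_commutator[OF this sE]
  have "product_of_conjugates 8 \<sigma> (A ** B ** s ** inv\<^bsub>GL\<^esub> (A ** B) ** inv\<^bsub>GL\<^esub> s)"
    by simp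
  moreover have "A ** B ** s = transvection j i (- a) ** (s ** (A ** B))"
    using A_s B_s by (metis matrix_mul_assoc)
  then have "A ** B ** s ** inv\<^bsub>GL\<^esub> (A ** B) ** inv\<^bsub>GL\<^esub> s = transvection j i (- a)"
    using GL AB_GL by (simp add: GL.inv_mult_group GL_cancel flip: matrix_mul_assoc)
  ultimately show ?thesis
    by (simp add: a_def)
qed

lemma product_of_8_conjugates:
  assumes "CARD('n) \<ge> 3" "i \<noteq> j" "k \<noteq> l"
  shows "product_of_conjugates 8 \<sigma> (transvection k l (\<sigma> $ i $ j))"
proof -
  have "\<not> UNIV \<subseteq> {i, j}"
  proof
    assume "UNIV \<subseteq> {i, j}"
    then have "CARD('n) \<le> card {i, j}"
      by (intro card_mono) auto
    with assms show False
      by simp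
  qed
  then obtain p where "p \<noteq> i" "p \<noteq> j"
    by auto
  then show ?thesis
    \<comment> \<open>Inversion corrects the sign of the transvection at (j, i), and
      \<open>p\<close> serves again as the spare index for moving it to (k, l).\<close>
    using product_of_conjugates_transvection_minus[OF product_of_8_conjugates_aux[of i j p]]
      product_of_conjugates_transvection_move[of 8 j i _ k l p] assms by auto
qed

section \<open>Differences of diagonal entries\<close>

lemma elementary_conjugates_subset:
  assumes "\<epsilon> \<in> elementary_group"
  shows "elementary_conjugates (\<epsilon> ** \<sigma> ** inv\<^bsub>GL\<^esub> \<epsilon>) \<subseteq> elementary_conjugates \<sigma>"
proof -
  have "\<sigma> \<in> elementary_conjugates \<sigma>"
    using product_of_conjugates_self by (simp only: product_of_conjugates_1)
  then have "\<epsilon> ** \<sigma> ** inv\<^bsub>GL\<^esub> \<epsilon> \<in> elementary_conjugates \<sigma>"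
    using assms by (intro elementary_conjugates_conj)
  \<comment> \<open>The conjugated matrix is itself an elementary \<sigma>-conjugate, and these are
    closed under inversion and elementary conjugation. Factor counts therefore carry over to
    \<sigma> unchanged.\<close>
  then show ?thesis
    using elementary_conjugates_conj elementary_conjugates_inv
    by (auto simp: elementary_conjugates_iff[of _ "\<epsilon> ** \<sigma> ** inv\<^bsub>GL\<^esub> \<epsilon>"])
qed

end

text \<open>The left factor adds row \<open>j\<close> to row \<open>i\<close>, and the right one
  subtracts column \<open>i\<close> from column \<open>j\<close>. Sandwiching between the diagonal
  units at \<open>i\<close> and \<open>j\<close> reads off the resulting entry.\<close>

lemma transvection_conjugate_nth:
  fixes \<sigma> :: "'a::comm_ring_1 ^ 'n::finite ^ 'n"
  assumes "i \<noteq> j"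
  shows "(transvection i j 1 ** \<sigma> ** transvection i j (- 1)) $ i $ j =
    \<sigma> $ i $ j + \<sigma> $ j $ j - \<sigma> $ i $ i - \<sigma> $ j $ i"
proof -
  have *: "matrix_unit i i 1 ** M ** matrix_unit j j 1 = matrix_unit i j (M $ i $ j)"
    for M :: "'a ^ 'n ^ 'n"
    by (simp add: matrix_unit_mult_mult)
  have "matrix_unit i i 1 ** transvection i j 1 = matrix_unit i i 1 + matrix_unit i j (1 :: 'a)"
    "transvection i j (- 1) ** matrix_unit j j 1 = matrix_unit j j 1 + matrix_unit i j (- 1 :: 'a)"
    using assms by (simp_all add: transvection_algebra)
  then have "matrix_unit i i 1 ** (transvection i j 1 ** \<sigma> ** transvection i j (- 1)) ** matrix_unit j j 1
    = (matrix_unit i i 1 + matrix_unit i j 1) ** \<sigma> ** (matrix_unit j j 1 + matrix_unit i j (- 1))"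
    by (metis matrix_mul_assoc)
  then have "matrix_unit i j ((transvection i j 1 ** \<sigma> ** transvection i j (- 1)) $ i $ j) =
    matrix_unit i j (\<sigma> $ i $ j + \<sigma> $ j $ j - \<sigma> $ i $ i - \<sigma> $ j $ i)"
    unfolding * matrix_add_ldistrib matrix_add_rdistrib' matrix_unit_mult_mult
    by (simp add: flip: matrix_unit_add) (simp add: algebra_simps)
  then have "matrix_unit i j ((transvection i j 1 ** \<sigma> ** transvection i j (- 1)) $ i $ j) $ i $ j =
    matrix_unit i j (\<sigma> $ i $ j + \<sigma> $ j $ j - \<sigma> $ i $ i - \<sigma> $ j $ i) $ i $ j"
    by simp
  then show ?thesis
    by (simp add: matrix_unit_def)
qed

theorem theorem12:
  fixes \<sigma> :: "'a::comm_ring_1 ^ 'n::finite ^ 'n::finite" and i j k l :: "'n::finite"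
  assumes "CARD('n) \<ge> 3"
    and "\<sigma> \<in> carrier GL"
    and "i \<noteq> j" and "k \<noteq> l"
  shows "product_of_conjugates 8 \<sigma> (transvection k l (\<sigma> $ i $ j)) \<and>
         product_of_conjugates 24 \<sigma> (transvection k l (\<sigma> $ i $ i - \<sigma> $ j $ j))"
proof
  note part1 = product_of_8_conjugates[OF _ assms(1) _ assms(4)]
  show ij: "product_of_conjugates 8 \<sigma> (transvection k l (\<sigma> $ i $ j))"
    using assms by (intro part1)
  have ji: "product_of_conjugates 8 \<sigma> (transvection k l (- (\<sigma> $ j $ i)))"
    using part1[of \<sigma> j i] product_of_conjugates_transvection_minus assms by auto
  let ?\<epsilon> = "transvection i j 1 :: 'a ^ 'n ^ 'n"
  let ?\<sigma> = "?\<epsilon> ** \<sigma> ** inv\<^bsub>GL\<^esub> ?\<epsilon>"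
  let ?d = "\<sigma> $ i $ j + \<sigma> $ j $ j - \<sigma> $ i $ i - \<sigma> $ j $ i"
  have "?\<sigma> \<in> carrier GL"
    using assms by (simp add: transvection_in_GL)
  then have "product_of_conjugates 8 ?\<sigma> (transvection k l (?\<sigma> $ i $ j))"
    using part1 assms(3) by blast
  also have "?\<sigma> $ i $ j = ?d"
    using assms(3) by (simp add: inv_transvection transvection_conjugate_nth)
  finally have "product_of_conjugates 8 \<sigma> (transvection k l ?d)"
    using elementary_conjugates_subset[OF assms(2) transvection_in_elementary_group[OF assms(3)]]
    unfolding product_of_conjugates_def by blast
  then have "product_of_conjugates 8 \<sigma> (transvection k l (- ?d))"
    using product_of_conjugates_transvection_minus assms by blast
  \<comment> \<open>The three arguments \<open>- ?d\<close>, \<open>\<sigma> $ i $ j\<close> and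
    \<open>- (\<sigma> $ j $ i)\<close> sum to the difference of the diagonal entries, and 24 = 8 +
    8 + 8.\<close>
  from product_of_conjugates_mult[OF assms(2) this product_of_conjugates_mult[OF assms(2) ij ji]]
  show "product_of_conjugates 24 \<sigma> (transvection k l (\<sigma> $ i $ i - \<sigma> $ j $ j))"
    using assms(4) by (simp add: transvection_mult)
qed

end
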